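(* Let $a_0,a_1,b_0,b_1$ be real numbers such that $a(N):=a_1N+a_0>0$ and $b(N):=b_1N+b_0>0$ for every positive integer $N$. For every integer $k\geq 1$, let $I_k(N)$ denote the quantity $I_k$ (defined in the context) computed with $N$ variables and parameters $a=a(N)$, $b=b(N)$. Then $\lim_{N\to\infty}\frac{I_k(N)}{N}$ exists and is finite.
   Context: For a positive integer $N$, real numbers $a,b>0$ and a function $f$ of $N$ variables, set $\langle f\rangle_{a,b}=\frac1{N!}\int_{[0,1]^N}f(x_1,\dots,x_N)\prod_{1\le i<j\le N}(x_i-x_j)^2\prod_{i=1}^Nx_i^{a-1}(1-x_i)^{b-1}\,dx_i$. Let $p_k(x_1,\dots,x_N)=\sum_{i=1}^N x_i^k$ be the $k$-th power sum and $I_k:=\langle p_k\rangle_{a,b}/\langle 1\rangle_{a,b}$. *)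

theory Defs
  imports "HOL-Analysis.Analysis"
begin

definition selberg_avg :: "nat \<Rightarrow> real \<Rightarrow> real \<Rightarrow> ((nat \<Rightarrow> real) \<Rightarrow> real) \<Rightarrow> real" where
  "selberg_avg N a b f =
     (1 / fact N) *
     (LINT x : (PiE {..<N} (\<lambda>_. {0..1::real})) | PiM {..<N} (\<lambda>_. lborel).
        f x * (\<Prod>i<N. \<Prod>j\<in>{i<..<N}. (x i - x j)^2)
            * (\<Prod>i<N. x i powr (a - 1) * (1 - x i) powr (b - 1)))"

definition power_sum :: "nat \<Rightarrow> nat \<Rightarrow> (nat \<Rightarrow> real) \<Rightarrow> real" where
  "power_sum N k x = (\<Sum>i<N. x i ^ k)"

definition I_moment :: "nat \<Rightarrow> real \<Rightarrow> real \<Rightarrow> nat \<Rightarrow> real" where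
  "I_moment N a b k = selberg_avg N a b (power_sum N k) / selberg_avg N a b (\<lambda>_. 1)"

end

theory Submission
  imports Defs
begin

text \<open>
  Integrating the \<open>x\<^sub>i\<close>-derivative of \<open>x\<^sub>i\<^sup>k\<^sup>+\<^sup>1 (1 - x\<^sub>i) T\<close> times the density, where \<open>T\<close> is a
  product of power sums, and summing over \<open>i\<close> yields the loop equations. They express
  \<open>\<langle>p\<^sub>k\<^sub>+\<^sub>1 T\<rangle>\<close> through the averages of \<open>p\<^sub>l p\<^sub>k\<^sub>-\<^sub>l T\<close>, of \<open>p\<^sub>l p\<^sub>k\<^sub>+\<^sub>1\<^sub>-\<^sub>l T\<close> with \<open>1 \<le> l \<le> k\<close> and of
  \<open>p\<^sub>k T\<close>, up to a term of lower order in \<open>N\<close>; the coefficient of \<open>\<langle>p\<^sub>k\<^sub>+\<^sub>1 T\<rangle>\<close> is \<open>2 N + a + b - 2\<close>,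
  and \<open>2 + a\<^sub>1 + b\<^sub>1\<close> does not vanish. Treating the normalised averages of all products of
  power sums simultaneously makes this system closed, so that no factorisation
  \<open>\<langle>p\<^sub>l p\<^sub>m\<rangle> \<sim> \<langle>p\<^sub>l\<rangle> \<langle>p\<^sub>m\<rangle>\<close> has to be proved: each equation replaces a part by smaller ones, and
  convergence follows by induction.
\<close>

subsection \<open>Integration by parts against the Jacobi weight\<close>

text \<open>The indicator belongs to the weight, so that integrals over the cube become integrals
  over the whole product space and Fubini applies without tracking domains.\<close>

definition jacobi_weight :: "real \<Rightarrow> real \<Rightarrow> real \<Rightarrow> real" where
  "jacobi_weight a b t = indicator {0..1} t * (t powr (a - 1) * (1 - t) powr (b - 1))"

lemma jacobi_weight_nonneg: "0 \<le> jacobi_weight a b t"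
  by (simp add: jacobi_weight_def)

lemma jacobi_weight_eq_0: "t \<notin> {0..1} \<Longrightarrow> jacobi_weight a b t = 0"
  by (simp add: jacobi_weight_def)

lemma jacobi_weight_measurable [measurable]: "jacobi_weight a b \<in> borel_measurable borel"
  unfolding jacobi_weight_def by measurable

lemma integrable_jacobi_weight:
  assumes "0 < a" "0 < b"
  shows "integrable lborel (jacobi_weight a b)"
  using integrable_Beta[OF assms] unfolding set_integrable_def jacobi_weight_def by simp

lemma integrable_mult_jacobi_weight:
  assumes "0 < a" "0 < b" and [measurable]: "g \<in> borel_measurable borel"
    and bound: "\<And>t. t \<in> {0..1} \<Longrightarrow> \<bar>g t\<bar> \<le> C"
  shows "integrable lborel (\<lambda>t. g t * jacobi_weight a b t)"
proof (rule Bochner_Integration.integrable_bound)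
  show "integrable lborel (\<lambda>t. C * jacobi_weight a b t)"
    using integrable_jacobi_weight[OF assms(1,2)] by simp
  have "\<bar>g t\<bar> * jacobi_weight a b t \<le> \<bar>C\<bar> * jacobi_weight a b t" for t
    using order_trans[OF bound abs_ge_self, of t] jacobi_weight_nonneg[of a b t]
    by (cases "t \<in> {0..1}") (auto intro: mult_right_mono simp: jacobi_weight_eq_0)
  then have "norm (g t * jacobi_weight a b t) \<le> norm (C * jacobi_weight a b t)" for t
    using jacobi_weight_nonneg[of a b t] by (simp add: abs_mult)
  then show "AE t in lborel. norm (g t * jacobi_weight a b t) \<le> norm (C * jacobi_weight a b t)"
    by simp
qed measurable

text \<open>The integrand is the derivative of \<open>P t * t powr a * (1 - t) powr b\<close>, whose
  values at 0 and 1 vanish. The factor \<open>t * (1 - t)\<close> built into that primitive keeps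
  everything integrable even if \<open>a < 1\<close> or \<open>b < 1\<close> makes the weight
  singular.\<close>

lemma jacobi_weight_integral_by_parts:
  assumes "0 < a" "0 < b"
    and deriv: "\<And>t. (P has_real_derivative P' t) (at t)"
    and [measurable]: "P' \<in> borel_measurable borel"
    and bound: "\<And>t. t \<in> {0..1} \<Longrightarrow> \<bar>P' t\<bar> \<le> C"
  shows "(LINT t|lborel. (P' t * (t * (1 - t)) + P t * (a * (1 - t) - b * t)) * jacobi_weight a b t) = 0"
proof -
  define G where "G t = P' t * (t * (1 - t)) + P t * (a * (1 - t) - b * t)" for t
  define w where "w t = t powr (a - 1) * (1 - t) powr (b - 1)" for t :: real
  have contP: "continuous_on A P" for A
    using deriv by (meson DERIV_isCont continuous_at_imp_continuous_on)
  have [measurable]: "P \<in> borel_measurable borel"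
    by (rule borel_measurable_continuous_onI) (rule contP)
  obtain D where D: "\<And>t. t \<in> {0..1} \<Longrightarrow> \<bar>P t\<bar> \<le> D"
    using compact_imp_bounded[OF compact_continuous_image[OF contP compact_Icc[of 0 "1::real"]]]
    by (fastforce simp: bounded_iff)
  \<comment> \<open>Boundedness of \<open>G\<close> gives Lebesgue integrability of
    \<open>G t * w t\<close>, which is needed to identify the gauge integral from the fundamental
    theorem with the Lebesgue integral.\<close>
  have "\<bar>G t\<bar> \<le> C * 1 + D * (a + b)" if t: "t \<in> {0..1}" for t
  proof -
    have "\<bar>t * (1 - t)\<bar> \<le> 1" using t by (auto simp: abs_mult intro!: mult_le_one)
    then have 1: "\<bar>P' t\<bar> * \<bar>t * (1 - t)\<bar> \<le> C * 1"
      using bound[OF t] by (intro mult_mono) auto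
    have "a * (1 - t) \<le> a" "0 \<le> a * (1 - t)" "b * t \<le> b" "0 \<le> b * t"
      using t assms(1,2) by (auto simp: mult_left_le algebra_simps)
    then have "\<bar>a * (1 - t) - b * t\<bar> \<le> a + b" by linarith
    then have 2: "\<bar>P t\<bar> * \<bar>a * (1 - t) - b * t\<bar> \<le> D * (a + b)"
      using D[OF t] by (intro mult_mono) auto
    show ?thesis using 1 2 unfolding G_def by (intro order_trans[OF abs_triangle_ineq add_mono]) (simp_all only: abs_mult)
  qed
  then have "integrable lborel (\<lambda>t. G t * jacobi_weight a b t)"
    by (intro integrable_mult_jacobi_weight assms) (auto simp: G_def)
  then have int: "set_integrable lborel {0..1} (\<lambda>t. G t * w t)"
    by (simp add: set_integrable_def jacobi_weight_def w_def mult_ac)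
  \<comment> \<open>The powers may fail to be differentiable at 0 and 1, so the fundamental theorem
    is used in the form that asks for derivatives only inside and for continuity up to the
    endpoints.\<close>
  have "((\<lambda>t. G t * w t) has_integral (P 1 * 1 powr a * (1 - 1) powr b - P 0 * 0 powr a * (1 - 0) powr b)) {0..1}"
  proof (rule fundamental_theorem_of_calculus_interior)
    show "continuous_on {0..1} (\<lambda>t. P t * t powr a * (1 - t) powr b)"
      using assms(1,2) by (intro continuous_intros contP continuous_on_powr') auto
    show "((\<lambda>t. P t * t powr a * (1 - t) powr b) has_vector_derivative G t * w t) (at t)"
      if "t \<in> {0<..<1}" for t
    proof -
      have t: "0 < t" "t < 1" using that by auto
      have e: "t powr a = t * t powr (a - 1)" "(1 - t) powr b = (1 - t) * (1 - t) powr (b - 1)"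
        using t by (simp_all add: powr_mult_base)
      have "((\<lambda>t. P t * t powr a * (1 - t) powr b) has_real_derivative
         (P' t * t powr a + P t * (a * t powr (a - 1))) * (1 - t) powr b
          + P t * t powr a * (- (b * (1 - t) powr (b - 1)))) (at t)"
        using t by (auto intro!: derivative_eq_intros deriv simp: powr_diff field_simps)
      also have "(P' t * t powr a + P t * (a * t powr (a - 1))) * (1 - t) powr b
          + P t * t powr a * (- (b * (1 - t) powr (b - 1))) = G t * w t"
        unfolding G_def w_def e by (simp add: algebra_simps)
      finally show ?thesis by (simp add: has_real_derivative_iff_has_vector_derivative)
    qed
  qed simp
  then have "((\<lambda>t. G t * w t) has_integral 0) {0..1}"
    using assms(1,2) by simp
  then have "(LINT t:{0..1}|lborel. G t * w t) = 0"
    using set_borel_integral_eq_integral(2)[OF int] by (simp add: integral_unique)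
  then show ?thesis
    by (simp add: set_lebesgue_integral_def jacobi_weight_def w_def G_def mult_ac)
qed

section \<open>Measurable functions bounded on the unit cube\<close>

definition cube_bounded :: "nat \<Rightarrow> ((nat \<Rightarrow> real) \<Rightarrow> real) \<Rightarrow> bool" where
  "cube_bounded N f \<longleftrightarrow> f \<in> borel_measurable (PiM {..<N} (\<lambda>_. lborel)) \<and>
     (\<exists>C. \<forall>x. (\<forall>i<N. x i \<in> {0..1}) \<longrightarrow> \<bar>f x\<bar> \<le> C)"

lemma cube_bounded_const [intro]: "cube_bounded N (\<lambda>_. c)"
  unfolding cube_bounded_def by auto

lemma cube_bounded_coord [intro]: "i < N \<Longrightarrow> cube_bounded N (\<lambda>x. x i)"
  unfolding cube_bounded_def by (auto intro!: exI[of _ 1] measurable_component_singleton[where M = "\<lambda>_. lborel", simplified])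

lemma cube_bounded_add [intro]:
  assumes "cube_bounded N f" "cube_bounded N g"
  shows "cube_bounded N (\<lambda>x. f x + g x)"
proof -
  obtain C D where "\<forall>x. (\<forall>i<N. x i \<in> {0..1}) \<longrightarrow> \<bar>f x\<bar> \<le> C" "\<forall>x. (\<forall>i<N. x i \<in> {0..1}) \<longrightarrow> \<bar>g x\<bar> \<le> D"
    using assms unfolding cube_bounded_def by blast
  then have "\<forall>x. (\<forall>i<N. x i \<in> {0..1}) \<longrightarrow> \<bar>f x + g x\<bar> \<le> C + D"
    by (blast intro: order_trans[OF abs_triangle_ineq add_mono])
  then show ?thesis using assms unfolding cube_bounded_def by (intro conjI exI) auto
qed

lemma cube_bounded_mult [intro]:
  assumes "cube_bounded N f" "cube_bounded N g"
  shows "cube_bounded N (\<lambda>x. f x * g x)"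
proof -
  obtain C D where "\<forall>x. (\<forall>i<N. x i \<in> {0..1}) \<longrightarrow> \<bar>f x\<bar> \<le> C" "\<forall>x. (\<forall>i<N. x i \<in> {0..1}) \<longrightarrow> \<bar>g x\<bar> \<le> D"
    using assms unfolding cube_bounded_def by blast
  then have "\<forall>x. (\<forall>i<N. x i \<in> {0..1}) \<longrightarrow> \<bar>f x * g x\<bar> \<le> C * D"
    unfolding abs_mult by (blast intro: mult_mono abs_ge_zero order_trans[OF abs_ge_zero])
  then show ?thesis using assms unfolding cube_bounded_def by (intro conjI exI) auto
qed

lemma cube_bounded_diff [intro]: "cube_bounded N f \<Longrightarrow> cube_bounded N g \<Longrightarrow> cube_bounded N (\<lambda>x. f x - g x)"
  using cube_bounded_add[of N f "\<lambda>x. (-1) * g x"] cube_bounded_mult[OF cube_bounded_const, of N g "-1"] by simp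

lemma cube_bounded_power [intro]: "cube_bounded N f \<Longrightarrow> cube_bounded N (\<lambda>x. f x ^ m)"
  by (induction m) auto

lemma cube_bounded_sum [intro]: "(\<And>s. s \<in> S \<Longrightarrow> cube_bounded N (f s)) \<Longrightarrow> cube_bounded N (\<lambda>x. \<Sum>s\<in>S. f s x)"
  by (induction S rule: infinite_finite_induct) auto

lemma cube_bounded_prod [intro]: "(\<And>s. s \<in> S \<Longrightarrow> cube_bounded N (f s)) \<Longrightarrow> cube_bounded N (\<lambda>x. \<Prod>s\<in>S. f s x)"
  by (induction S rule: infinite_finite_induct) auto

section \<open>Integration against the product Jacobi density\<close>

interpretation lborel_prod: product_sigma_finite "\<lambda>_ :: nat. lborel :: real measure"
  by standard

text \<open>The Vandermonde factor is left out on purpose: the density is then a product over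
  coordinates, and the discriminant enters as part of the integrand.\<close>

definition jacobi_density :: "nat \<Rightarrow> real \<Rightarrow> real \<Rightarrow> (nat \<Rightarrow> real) \<Rightarrow> real" where
  "jacobi_density N a b x = (\<Prod>i<N. jacobi_weight a b (x i))"

definition jacobi_integral :: "nat \<Rightarrow> real \<Rightarrow> real \<Rightarrow> ((nat \<Rightarrow> real) \<Rightarrow> real) \<Rightarrow> real" where
  "jacobi_integral N a b f = (LINT x|PiM {..<N} (\<lambda>_. lborel). f x * jacobi_density N a b x)"

lemma jacobi_density_nonneg: "0 \<le> jacobi_density N a b x"
  unfolding jacobi_density_def by (intro prod_nonneg ballI jacobi_weight_nonneg)

lemma jacobi_density_eq_0: "i < N \<Longrightarrow> x i \<notin> {0..1} \<Longrightarrow> jacobi_density N a b x = 0"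
  unfolding jacobi_density_def using jacobi_weight_eq_0 by (intro prod_zero) blast+

lemma integrable_jacobi_density:
  assumes "0 < a" "0 < b"
  shows "integrable (PiM {..<N} (\<lambda>_. lborel)) (jacobi_density N a b)"
  using lborel_prod.product_integrable_prod[of "{..<N}" "\<lambda>_. jacobi_weight a b"]
    integrable_jacobi_weight[OF assms]
  unfolding jacobi_density_def by simp

text \<open>The density vanishes off the cube, so a bound on the cube alone gives domination by a
  multiple of the density. The closure rules for \<open>cube_bounded\<close> then settle every
  integrability question below.\<close>

lemma integrable_cube_bounded:
  assumes "0 < a" "0 < b" "cube_bounded N f"
  shows "integrable (PiM {..<N} (\<lambda>_. lborel)) (\<lambda>x. f x * jacobi_density N a b x)"
proof -
  obtain C where C: "\<And>x. (\<And>i. i < N \<Longrightarrow> x i \<in> {0..1}) \<Longrightarrow> \<bar>f x\<bar> \<le> C"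
    and [measurable]: "f \<in> borel_measurable (PiM {..<N} (\<lambda>_. lborel))"
    using assms(3) unfolding cube_bounded_def by blast
  note int = integrable_jacobi_density[OF assms(1,2), of N]
  show ?thesis
  proof (rule Bochner_Integration.integrable_bound)
    show "integrable (PiM {..<N} (\<lambda>_. lborel)) (\<lambda>x. C * jacobi_density N a b x)"
      using int by simp
    have "\<bar>f x\<bar> * jacobi_density N a b x \<le> \<bar>C\<bar> * jacobi_density N a b x" for x
      using order_trans[OF C abs_ge_self, of x] jacobi_density_nonneg[of N a b x] jacobi_density_eq_0[of _ N x a b]
      by (cases "\<forall>i<N. x i \<in> {0..1}") (auto intro: mult_right_mono)
    then have "norm (f x * jacobi_density N a b x) \<le> norm (C * jacobi_density N a b x)" for x
      using jacobi_density_nonneg[of N a b x] by (simp add: abs_mult)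
    then show "AE x in PiM {..<N} (\<lambda>_. lborel). norm (f x * jacobi_density N a b x) \<le> norm (C * jacobi_density N a b x)"
      by simp
    show "(\<lambda>x. f x * jacobi_density N a b x) \<in> borel_measurable (PiM {..<N} (\<lambda>_. lborel))"
      using borel_measurable_integrable[OF int] by measurable
  qed
qed

lemma jacobi_integral_add:
  assumes "0 < a" "0 < b" "cube_bounded N f" "cube_bounded N g"
  shows "jacobi_integral N a b (\<lambda>x. f x + g x) = jacobi_integral N a b f + jacobi_integral N a b g"
  unfolding jacobi_integral_def distrib_right
  by (intro Bochner_Integration.integral_add integrable_cube_bounded assms)

lemma jacobi_integral_cmult: "jacobi_integral N a b (\<lambda>x. c * f x) = c * jacobi_integral N a b f"
  unfolding jacobi_integral_def by (simp add: mult.assoc)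

lemma jacobi_integral_sum:
  assumes "0 < a" "0 < b" "\<And>s. s \<in> S \<Longrightarrow> cube_bounded N (f s)"
  shows "jacobi_integral N a b (\<lambda>x. \<Sum>s\<in>S. f s x) = (\<Sum>s\<in>S. jacobi_integral N a b (f s))"
  unfolding jacobi_integral_def sum_distrib_right
  by (intro Bochner_Integration.integral_sum integrable_cube_bounded assms)

lemma jacobi_integral_mono:
  assumes "0 < a" "0 < b" "cube_bounded N f" "cube_bounded N g"
    and le: "\<And>x. (\<And>i. i < N \<Longrightarrow> x i \<in> {0..1}) \<Longrightarrow> f x \<le> g x"
  shows "jacobi_integral N a b f \<le> jacobi_integral N a b g"
  unfolding jacobi_integral_def
proof (intro integral_mono integrable_cube_bounded assms)
  show "f x * jacobi_density N a b x \<le> g x * jacobi_density N a b x" for x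
    using le[of x] jacobi_density_nonneg[of N a b x] jacobi_density_eq_0[of _ N x a b]
    by (cases "\<forall>i<N. x i \<in> {0..1}") (auto intro: mult_right_mono)
qed

text \<open>By Fubini the integral over \<open>x i\<close> can be taken first. With the other
  coordinates fixed, it is the one-dimensional identity times a constant.\<close>

lemma jacobi_integral_by_parts:
  assumes "0 < a" "0 < b" and i: "i < N" and Q: "cube_bounded N Q" and Q': "cube_bounded N Q'"
    and deriv: "\<And>x t. ((\<lambda>t. Q (x(i := t))) has_real_derivative Q' (x(i := t))) (at t)"
  shows "jacobi_integral N a b (\<lambda>x. Q' x * (x i * (1 - x i)) + Q x * (a * (1 - x i) - b * x i)) = 0"
proof -
  define I where "I = {..<N} - {i}"
  define F where "F x = Q' x * (x i * (1 - x i)) + Q x * (a * (1 - x i) - b * x i)" for x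
  have I: "finite I" "i \<notin> I" "{..<N} = insert i I" using i by (auto simp: I_def)
  have "cube_bounded N F" unfolding F_def using i by (intro cube_bounded_add cube_bounded_mult cube_bounded_diff cube_bounded_const cube_bounded_coord Q Q')
  then have int: "integrable (PiM (insert i I) (\<lambda>_. lborel)) (\<lambda>x. F x * jacobi_density N a b x)"
    using integrable_cube_bounded[OF assms(1,2)] I(3) by metis
  obtain C where C: "\<And>x. (\<And>i. i < N \<Longrightarrow> x i \<in> {0..1}) \<Longrightarrow> \<bar>Q' x\<bar> \<le> C"
    and Q'_meas[measurable]: "Q' \<in> borel_measurable (PiM (insert i I) (\<lambda>_. lborel))"
    using Q' I(3) unfolding cube_bounded_def by metis
  have dens: "jacobi_density N a b (x(i := y)) = jacobi_weight a b y * (\<Prod>j\<in>I. jacobi_weight a b (x j))" for x y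
  proof -
    have "(\<Prod>j\<in>I. jacobi_weight a b ((x(i := y)) j)) = (\<Prod>j\<in>I. jacobi_weight a b (x j))"
      using I(2) by (intro prod.cong) auto
    then show ?thesis unfolding jacobi_density_def I(3) using I(1,2) by simp
  qed
  have inner: "(LINT y|lborel. F (x(i := y)) * jacobi_density N a b (x(i := y))) = 0"
    if x: "x \<in> space (PiM I (\<lambda>_. lborel))" for x
  \<comment> \<open>The bound \<open>C\<close> on \<open>Q'\<close> is available only when the
    remaining coordinates lie in the unit interval; otherwise a factor of the density is
    zero.\<close>
  proof (cases "\<forall>j\<in>I. x j \<in> {0..1}")
    case True
    have [measurable]: "(\<lambda>t. x(i := t)) \<in> measurable borel (PiM (insert i I) (\<lambda>_. lborel))"
      using measurable_component_update[OF x I(2)] by simp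
    have "(LINT y|lborel. (Q' (x(i := y)) * (y * (1 - y)) + Q (x(i := y)) * (a * (1 - y) - b * y)) * jacobi_weight a b y) = 0"
    proof (rule jacobi_weight_integral_by_parts[OF assms(1,2) deriv])
      show "(\<lambda>t. Q' (x(i := t))) \<in> borel_measurable borel" by measurable
      show "\<bar>Q' (x(i := t))\<bar> \<le> C" if "t \<in> {0..1}" for t
        by (rule C) (use True that in \<open>auto simp: I_def\<close>)
    qed
    then show ?thesis
      unfolding dens F_def by (simp flip: mult.assoc)
  next
    case False
    then have "(\<Prod>j\<in>I. jacobi_weight a b (x j)) = 0"
      using I(1) by (metis jacobi_weight_eq_0 prod_zero)
    then show ?thesis unfolding dens by simp
  qed
  have "jacobi_integral N a b F = (LINT x|PiM I (\<lambda>_. lborel). LINT y|lborel. F (x(i := y)) * jacobi_density N a b (x(i := y)))"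
    unfolding jacobi_integral_def I(3)
    using lborel_prod.product_integral_insert[OF I(1,2) int] by simp
  also have "\<dots> = (LINT x|PiM I (\<lambda>_. lborel :: real measure). (0::real))"
    by (rule Bochner_Integration.integral_cong[OF refl inner])
  finally show ?thesis by (simp add: F_def[abs_def])
qed

subsection \<open>The squared Vandermonde determinant\<close>

definition index_pairs :: "nat \<Rightarrow> (nat \<times> nat) set" where
  "index_pairs N = (SIGMA p:{..<N}. {p<..<N})"

definition disc :: "nat \<Rightarrow> (nat \<Rightarrow> real) \<Rightarrow> real" where
  "disc N x = (\<Prod>(p, q)\<in>index_pairs N. (x p - x q)\<^sup>2)"

text \<open>This is the product rule written without division. Where the coordinates are distinct it
  equals \<open>disc N x\<close> times the sum of \<open>2 / (x i - x j)\<close> over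
  \<open>j\<close> different from \<open>i\<close>, but it stays valid when coordinates
  coincide.\<close>

definition disc_deriv :: "nat \<Rightarrow> nat \<Rightarrow> (nat \<Rightarrow> real) \<Rightarrow> real" where
  "disc_deriv N i x = (\<Sum>(p, q)\<in>index_pairs N. 2 * (x p - x q) * (of_bool (p = i) - of_bool (q = i))
     * (\<Prod>(r, s)\<in>index_pairs N - {(p, q)}. (x r - x s)\<^sup>2))"

lemma index_pairs_finite [simp]: "finite (index_pairs N)"
  by (simp add: index_pairs_def)

lemma index_pairsD: "(p, q) \<in> index_pairs N \<Longrightarrow> p < q \<and> q < N"
  by (auto simp: index_pairs_def)

lemma disc_eq: "disc N x = (\<Prod>p<N. \<Prod>q\<in>{p<..<N}. (x p - x q)\<^sup>2)"
  by (simp add: disc_def index_pairs_def prod.Sigma)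

lemma disc_nonneg: "0 \<le> disc N x"
  by (auto simp: disc_def intro!: prod_nonneg)

lemma cube_bounded_disc: "cube_bounded N (disc N)"
  unfolding disc_def by (auto dest!: index_pairsD intro!: cube_bounded_prod cube_bounded_power cube_bounded_diff cube_bounded_coord)

lemma cube_bounded_disc_deriv: "cube_bounded N (disc_deriv N i)"
  unfolding disc_deriv_def case_prod_beta
  by (intro cube_bounded_sum cube_bounded_mult cube_bounded_const cube_bounded_diff cube_bounded_prod cube_bounded_power cube_bounded_coord)
     (auto dest: index_pairsD)

lemma coord_has_real_derivative:
  "((\<lambda>t. (x(i := t)) j) has_real_derivative of_bool (j = i)) (at t)"
  by (cases "j = i") auto

lemma disc_has_real_derivative:
  "((\<lambda>t. disc N (x(i := t))) has_real_derivative disc_deriv N i (x(i := t))) (at t)"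
proof -
  define f where "f s t = ((x(i := t)) (fst s) - (x(i := t)) (snd s))\<^sup>2" for s t
  have "(f s has_real_derivative 2 * ((x(i := t)) (fst s) - (x(i := t)) (snd s)) *
      (of_bool (fst s = i) - of_bool (snd s = i))) (at t)" for s
    unfolding f_def
    by (rule DERIV_cong[OF DERIV_power[OF DERIV_diff[OF coord_has_real_derivative coord_has_real_derivative]]]) simp
  from has_field_derivative_prod[of "index_pairs N" f, OF this] show ?thesis
    unfolding disc_def disc_deriv_def case_prod_beta f_def by simp
qed

text \<open>Sums over pairs \<open>p < q\<close> do not factorise, but sums over the full square do;
  the price is the diagonal. Raising \<open>N\<close> by one adds a row and a column that agree by
  symmetry.\<close>

lemma sum_square_symmetric:
  fixes f :: "nat \<Rightarrow> nat \<Rightarrow> real"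
  assumes sym: "\<And>p q. f p q = f q p"
  shows "(\<Sum>p<N. \<Sum>q<N. f p q) = (\<Sum>(p, q)\<in>index_pairs N. 2 * f p q) + (\<Sum>p<N. f p p)"
proof -
  have "(\<Sum>p<N. \<Sum>q<N. f p q) = (\<Sum>p<N. \<Sum>q\<in>{p<..<N}. 2 * f p q) + (\<Sum>p<N. f p p)"
  proof (induction N)
    case (Suc N)
    have "(\<Sum>q\<in>{p<..<Suc N}. 2 * f p q) = (\<Sum>q\<in>{p<..<N}. 2 * f p q) + 2 * f p N" if "p < N" for p
    proof -
      have "{p<..<Suc N} = insert N {p<..<N}" using that by auto
      then show ?thesis by simp
    qed
    then have "(\<Sum>p<N. \<Sum>q\<in>{p<..<Suc N}. 2 * f p q) = (\<Sum>p<N. \<Sum>q\<in>{p<..<N}. 2 * f p q) + 2 * (\<Sum>p<N. f p N)"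
      by (simp add: sum.distrib sum_distrib_left)
    moreover have "{N<..<Suc N} = {}" by auto
    moreover have "(\<Sum>p<N. f N p) = (\<Sum>p<N. f p N)"
      by (simp add: sym[of N])
    ultimately show ?case using Suc
      by (simp add: sum.distrib)
  qed simp
  then show ?thesis by (simp add: index_pairs_def sum.Sigma)
qed

text \<open>
  Exchanging the two sums symmetrises the interaction: the pair \<open>(p, q)\<close> receives
  \<open>x\<^sub>p\<^sup>m\<^sup>+\<^sup>1 - x\<^sub>q\<^sup>m\<^sup>+\<^sup>1\<close>, which is divisible by \<open>x\<^sub>p - x\<^sub>q\<close>.
\<close>

lemma sum_power_mult_disc_deriv:
  "(\<Sum>i<N. x i ^ Suc m * disc_deriv N i x) =
     disc N x * ((\<Sum>l\<le>m. power_sum N l x * power_sum N (m - l) x) - (real m + 1) * power_sum N m x)"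
proof -
  \<comment> \<open>\<open>h u v\<close> is the polynomial quotient of
    \<open>u ^ Suc m - v ^ Suc m\<close> by \<open>u - v\<close>. Its diagonal value is the source
    of the correction \<open>(real m + 1) * power_sum N m x\<close>.\<close>
  define h where "h u v = (\<Sum>l\<le>m. u ^ l * v ^ (m - l))" for u v :: real
  have h_sym: "h u v = h v u" for u v
    unfolding h_def by (rule sum.reindex_bij_witness[of _ "\<lambda>l. m - l" "\<lambda>l. m - l"]) (auto simp: mult_ac)
  have h_diff: "u ^ Suc m - v ^ Suc m = (u - v) * h u v" for u v
    using diff_power_eq_sum[of u m v] by (simp add: h_def lessThan_Suc_atMost)
  have h_diag: "h u u = (real m + 1) * u ^ m" for u
    by (simp add: h_def flip: power_add)
  have "(\<Sum>i<N. x i ^ Suc m * disc_deriv N i x) =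
      (\<Sum>(p, q)\<in>index_pairs N. \<Sum>i<N. x i ^ Suc m * (2 * (x p - x q) * (of_bool (p = i) - of_bool (q = i))
     * (\<Prod>(r, s)\<in>index_pairs N - {(p, q)}. (x r - x s)\<^sup>2)))"
    unfolding disc_deriv_def sum_distrib_left case_prod_beta by (rule sum.swap)
  also have "\<dots> = (\<Sum>(p, q)\<in>index_pairs N. disc N x * (2 * h (x p) (x q)))"
  proof (intro sum.cong refl, clarify)
    fix p q assume pq: "(p, q) \<in> index_pairs N"
    define R where "R = (\<Prod>(r, s)\<in>index_pairs N - {(p, q)}. (x r - x s)\<^sup>2)"
    have *: "(\<Sum>i<N. x i ^ Suc m * of_bool (j = i)) = x j ^ Suc m" if "j < N" for j
    proof -
      have "(\<Sum>i<N. x i ^ Suc m * of_bool (j = i)) = (\<Sum>i<N. if j = i then x i ^ Suc m else 0)"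
        by (intro sum.cong) auto
      then show ?thesis using that by (simp add: sum.delta del: power_Suc)
    qed
    have "(\<Sum>i<N. x i ^ Suc m * (2 * (x p - x q) * (of_bool (p = i) - of_bool (q = i)) * R)) =
        2 * (x p - x q) * R * ((\<Sum>i<N. x i ^ Suc m * of_bool (p = i)) - (\<Sum>i<N. x i ^ Suc m * of_bool (q = i)))"
      unfolding sum_subtractf[symmetric] sum_distrib_left by (intro sum.cong) (auto simp: algebra_simps)
    also have "\<dots> = 2 * (x p - x q) * R * (x p ^ Suc m - x q ^ Suc m)"
      using index_pairsD[OF pq] by (simp only: *[of p] *[of q] less_trans[of p q N])
    \<comment> \<open>The second factor \<open>x p - x q\<close> extracted from the power difference
      completes the square that is missing in \<open>R\<close>, which restores the
      discriminant.\<close>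
    also have "\<dots> = ((x p - x q)\<^sup>2 * R) * (2 * h (x p) (x q))"
      unfolding h_diff by (simp add: power2_eq_square)
    also have "(x p - x q)\<^sup>2 * R = disc N x"
      unfolding disc_def R_def using prod.remove[OF index_pairs_finite pq, of "\<lambda>(r, s). (x r - x s)\<^sup>2"] by simp
    finally show "(\<Sum>i<N. x i ^ Suc m * (2 * (x p - x q) * (of_bool (p = i) - of_bool (q = i)) * R)) =
      disc N x * (2 * h (x p) (x q))" .
  qed
  also have "\<dots> = disc N x * (\<Sum>(p, q)\<in>index_pairs N. 2 * h (x p) (x q))"
    by (simp add: sum_distrib_left case_prod_beta)
  also have "(\<Sum>(p, q)\<in>index_pairs N. 2 * h (x p) (x q)) = (\<Sum>p<N. \<Sum>q<N. h (x p) (x q)) - (\<Sum>p<N. h (x p) (x p))"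
    using sum_square_symmetric[of "\<lambda>p q. h (x p) (x q)" N] h_sym by simp
  also have "(\<Sum>p<N. h (x p) (x p)) = (real m + 1) * power_sum N m x"
    by (simp add: h_diag power_sum_def sum_distrib_left)
  also have "(\<Sum>p<N. \<Sum>q<N. h (x p) (x q)) = (\<Sum>p<N. \<Sum>l\<le>m. \<Sum>q<N. x p ^ l * x q ^ (m - l))"
    unfolding h_def by (intro sum.cong refl sum.swap)
  also have "\<dots> = (\<Sum>l\<le>m. \<Sum>p<N. \<Sum>q<N. x p ^ l * x q ^ (m - l))"
    by (rule sum.swap)
  also have "\<dots> = (\<Sum>l\<le>m. power_sum N l x * power_sum N (m - l) x)"
    by (simp add: power_sum_def sum_product)
  finally show ?thesis .
qed

subsection \<open>Products of power sums\<close>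

definition power_sum_prod :: "nat \<Rightarrow> nat list \<Rightarrow> (nat \<Rightarrow> real) \<Rightarrow> real" where
  "power_sum_prod N ms x = (\<Prod>m\<leftarrow>ms. power_sum N m x)"

lemma power_sum_prod_simps [simp]:
  "power_sum_prod N [] x = 1"
  "power_sum_prod N (m # ms) x = power_sum N m x * power_sum_prod N ms x"
  by (simp_all add: power_sum_prod_def)

text \<open>The recursion is the product rule for the partial derivative in \<open>x i\<close>. For
  a part \<open>m = 0\<close> the truncated exponent \<open>m - 1\<close> is harmless because the
  factor \<open>real m\<close> is zero.\<close>

fun power_sum_prod_deriv :: "nat \<Rightarrow> nat \<Rightarrow> nat list \<Rightarrow> (nat \<Rightarrow> real) \<Rightarrow> real" where
  "power_sum_prod_deriv N i [] x = 0"
| "power_sum_prod_deriv N i (m # ms) x =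
     real m * x i ^ (m - 1) * power_sum_prod N ms x + power_sum N m x * power_sum_prod_deriv N i ms x"

lemma power_sum_0 [simp]: "power_sum N 0 x = real N"
  by (simp add: power_sum_def)

lemma cube_bounded_power_sum: "cube_bounded N (power_sum N m)"
  unfolding power_sum_def by (intro cube_bounded_sum cube_bounded_power cube_bounded_coord) simp

lemma cube_bounded_power_sum_prod: "cube_bounded N (power_sum_prod N ms)"
  by (induction ms) (auto simp: power_sum_prod_simps[abs_def] cube_bounded_power_sum)

lemma cube_bounded_power_sum_prod_deriv: "i < N \<Longrightarrow> cube_bounded N (power_sum_prod_deriv N i ms)"
  by (induction ms) (auto simp: power_sum_prod_deriv.simps[abs_def]
      intro!: cube_bounded_add cube_bounded_mult cube_bounded_power_sum cube_bounded_power_sum_prod)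

lemma power_sum_has_real_derivative:
  assumes "i < N"
  shows "((\<lambda>t. power_sum N m (x(i := t))) has_real_derivative real m * (x(i := t)) i ^ (m - 1)) (at t)"
proof -
  have "((\<lambda>t. \<Sum>j<N. (x(i := t)) j ^ m) has_real_derivative
     (\<Sum>j<N. if j = i then real m * t ^ (m - 1) else 0)) (at t)"
    by (intro DERIV_sum) (auto intro!: derivative_eq_intros)
  then show ?thesis using assms by (simp add: power_sum_def)
qed

lemma power_sum_prod_has_real_derivative:
  assumes "i < N"
  shows "((\<lambda>t. power_sum_prod N ms (x(i := t))) has_real_derivative
     power_sum_prod_deriv N i ms (x(i := t))) (at t)"
proof (induction ms)
  case (Cons m ms)
  show ?case
    unfolding power_sum_prod_simps power_sum_prod_deriv.simps
    by (rule DERIV_cong[OF DERIV_mult[OF power_sum_has_real_derivative[OF assms] Cons.IH]]) (simp only: mult_ac)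
qed simp

lemma power_sum_bounds:
  assumes "\<And>i. i < N \<Longrightarrow> x i \<in> {0..1}"
  shows "0 \<le> power_sum N m x" "power_sum N m x \<le> real N"
proof -
  show "0 \<le> power_sum N m x"
    unfolding power_sum_def using assms by (intro sum_nonneg) auto
  have "power_sum N m x \<le> (\<Sum>i<N. 1)"
    unfolding power_sum_def using assms by (intro sum_mono power_le_one) auto
  then show "power_sum N m x \<le> real N" by simp
qed

lemma power_sum_prod_bounds:
  assumes "\<And>i. i < N \<Longrightarrow> x i \<in> {0..1}"
  shows "0 \<le> power_sum_prod N ms x \<and> power_sum_prod N ms x \<le> real N ^ length ms"
  by (induction ms) (auto intro!: mult_mono mult_nonneg_nonneg power_sum_bounds[of N x] dest: assms)

text \<open>Differentiating in one coordinate turns a factor of size up to \<open>N\<close> into one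
  of size at most \<open>m\<close>, so a power of \<open>N\<close> is lost. The factor
  \<open>real N\<close> stands on the left to avoid the exponent \<open>length ms - 1\<close>, which
  would be truncated for the empty list.\<close>

lemma power_sum_prod_deriv_bound:
  assumes x: "\<And>i. i < N \<Longrightarrow> x i \<in> {0..1}" and i: "i < N"
  shows "real N * \<bar>power_sum_prod_deriv N i ms x\<bar> \<le> real (sum_list ms) * real N ^ length ms"
proof (induction ms)
  case (Cons m ms)
  have "\<bar>x i ^ (m - 1)\<bar> \<le> 1" using x[OF i] by (auto simp: power_le_one)
  then have "\<bar>real m * x i ^ (m - 1) * power_sum_prod N ms x\<bar> \<le> real m * 1 * real N ^ length ms"
    unfolding abs_mult using power_sum_prod_bounds[of N x ms] x by (intro mult_mono) auto
  then have 1: "real N * \<bar>real m * x i ^ (m - 1) * power_sum_prod N ms x\<bar> \<le> real N * (real m * 1 * real N ^ length ms)"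
    by (intro mult_left_mono) auto
  have 2: "power_sum N m x * (real N * \<bar>power_sum_prod_deriv N i ms x\<bar>) \<le> real N * (real (sum_list ms) * real N ^ length ms)"
    using power_sum_bounds[of N x m] x by (intro mult_mono Cons.IH) auto
  have "real N * \<bar>power_sum_prod_deriv N i (m # ms) x\<bar>
      \<le> real N * (\<bar>real m * x i ^ (m - 1) * power_sum_prod N ms x\<bar> + \<bar>power_sum N m x * power_sum_prod_deriv N i ms x\<bar>)"
    unfolding power_sum_prod_deriv.simps by (intro mult_left_mono abs_triangle_ineq) auto
  also have "\<dots> = real N * \<bar>real m * x i ^ (m - 1) * power_sum_prod N ms x\<bar>
      + power_sum N m x * (real N * \<bar>power_sum_prod_deriv N i ms x\<bar>)"
    using power_sum_bounds[of N x m] x by (simp add: abs_mult distrib_left)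
  also have "\<dots> \<le> real N * (real m * 1 * real N ^ length ms) + real N * (real (sum_list ms) * real N ^ length ms)"
    by (rule add_mono[OF 1 2])
  also have "\<dots> = real (sum_list (m # ms)) * real N ^ length (m # ms)"
    by (simp add: algebra_simps)
  finally show ?case .
qed simp

subsection \<open>Loop equations\<close>

text \<open>This collects the terms in which the derivative falls on the product of power
  sums.\<close>

definition loop_remainder :: "nat \<Rightarrow> nat \<Rightarrow> nat list \<Rightarrow> (nat \<Rightarrow> real) \<Rightarrow> real" where
  "loop_remainder N k ms x = (\<Sum>i<N. x i ^ Suc k * (1 - x i) * power_sum_prod_deriv N i ms x)"

lemma cube_bounded_loop_remainder: "cube_bounded N (loop_remainder N k ms)"
  unfolding loop_remainder_def
  by (intro cube_bounded_sum cube_bounded_mult cube_bounded_diff cube_bounded_const cube_bounded_power cube_bounded_coord cube_bounded_power_sum_prod_deriv) auto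

text \<open>Each of the \<open>N\<close> summands has lost one power of \<open>N\<close>, so the sum
  has order \<open>N ^ length ms\<close>, two powers below the quadratic terms of the loop
  equation.\<close>

lemma loop_remainder_bound:
  assumes x: "\<And>i. i < N \<Longrightarrow> x i \<in> {0..1}"
  shows "\<bar>loop_remainder N k ms x\<bar> \<le> real (sum_list ms) * real N ^ length ms"
proof (cases "N = 0")
  case False
  have "\<bar>x i ^ Suc k * (1 - x i) * power_sum_prod_deriv N i ms x\<bar> \<le> real (sum_list ms) * real N ^ length ms / real N"
    if "i < N" for i
  proof -
    have "\<bar>x i ^ Suc k * (1 - x i)\<bar> \<le> 1"
      unfolding abs_mult using x[OF that] by (intro mult_le_one) (auto simp: power_le_one abs_mult intro!: mult_le_one)
    then have "\<bar>x i ^ Suc k * (1 - x i)\<bar> * \<bar>power_sum_prod_deriv N i ms x\<bar> \<le> 1 * \<bar>power_sum_prod_deriv N i ms x\<bar>"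
      by (intro mult_right_mono) auto
    also have "\<dots> \<le> real (sum_list ms) * real N ^ length ms / real N"
      using power_sum_prod_deriv_bound[OF x that, where ms = ms] False by (simp add: field_simps)
    finally show ?thesis by (simp only: abs_mult)
  qed
  then have "\<bar>loop_remainder N k ms x\<bar> \<le> (\<Sum>i<N. real (sum_list ms) * real N ^ length ms / real N)"
    unfolding loop_remainder_def by (intro order_trans[OF sum_abs sum_mono]) auto
  then show ?thesis using False by simp
qed (simp add: loop_remainder_def)

lemma loop_equation_integral:
  assumes "0 < a" "0 < b"
  shows "jacobi_integral N a b (\<lambda>x. disc N x * (power_sum_prod N ms x *
      ((a - 1) * power_sum N k x - (a + b - 2) * power_sum N (Suc k) x
       + (\<Sum>l\<le>k. power_sum N l x * power_sum N (k - l) x)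
       - (\<Sum>l\<le>Suc k. power_sum N l x * power_sum N (Suc k - l) x)) + loop_remainder N k ms x)) = 0"
    (is "jacobi_integral N a b ?F = 0")
proof -
  define T where "T = power_sum_prod N ms"
  define T' where "T' i = power_sum_prod_deriv N i ms" for i
  \<comment> \<open>Only \<open>x i ^ k\<close> appears here; the further factor
    \<open>x i * (1 - x i)\<close> is supplied by \<open>jacobi_integral_by_parts\<close>.\<close>
  define Q where "Q i x = x i ^ k * T x * disc N x" for i x
  define Q' where "Q' i x = (real k * x i ^ (k - 1) * T x + x i ^ k * T' i x) * disc N x
     + x i ^ k * T x * disc_deriv N i x" for i x
  define G where "G i x = Q' i x * (x i * (1 - x i)) + Q i x * (a * (1 - x i) - b * x i)" for i x
  have cube_bounded: "cube_bounded N (Q i)" "cube_bounded N (Q' i)" if "i < N" for i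
    unfolding Q_def Q'_def T_def T'_def using that
    by (intro cube_bounded_add cube_bounded_mult cube_bounded_power cube_bounded_coord cube_bounded_const cube_bounded_disc cube_bounded_disc_deriv cube_bounded_power_sum_prod
        cube_bounded_power_sum_prod_deriv; simp)+
  have 0: "jacobi_integral N a b (G i) = 0" if "i < N" for i
    unfolding G_def
  proof (rule jacobi_integral_by_parts[OF assms that cube_bounded[OF that]])
    fix x t
    have pow: "((\<lambda>t. (x(i := t)) i ^ k) has_real_derivative real k * (x(i := t)) i ^ (k - 1)) (at t)"
      by (auto intro!: derivative_eq_intros)
    show "((\<lambda>t. Q i (x(i := t))) has_real_derivative Q' i (x(i := t))) (at t)"
      unfolding Q_def Q'_def T_def T'_def
      by (rule DERIV_cong[OF DERIV_mult[OF DERIV_mult[OF pow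
            power_sum_prod_has_real_derivative[OF that]] disc_has_real_derivative]])
         (simp only: algebra_simps)
  qed
  have pk: "(\<Sum>i<N. x i ^ k) = power_sum N k x" "(\<Sum>i<N. x i ^ Suc k) = power_sum N (Suc k) x" for x
    by (simp_all only: power_sum_def)
  have "(\<Sum>i<N. G i x) = ?F x" for x
  proof -
    have Gi: "G i x = disc N x * T x * ((real k + a) * x i ^ k - (real k + a + b) * x i ^ Suc k)
        + disc N x * (x i ^ Suc k * (1 - x i) * T' i x)
        + T x * (x i ^ Suc k * disc_deriv N i x) - T x * (x i ^ Suc (Suc k) * disc_deriv N i x)" for i
    proof -
      have e: "real k * x i ^ (k - 1) * x i = real k * x i ^ k" by (cases k) auto
      have "G i x = (real k * x i ^ (k - 1) * x i) * T x * (1 - x i) * disc N x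
         + x i ^ k * T' i x * disc N x * (x i * (1 - x i))
         + x i ^ k * T x * disc_deriv N i x * (x i * (1 - x i))
         + x i ^ k * T x * disc N x * (a * (1 - x i) - b * x i)"
        unfolding G_def Q_def Q'_def by (simp add: algebra_simps)
      then show ?thesis unfolding e by (simp add: algebra_simps)
    qed
    have "(\<Sum>i<N. G i x) = disc N x * T x * ((real k + a) * power_sum N k x - (real k + a + b) * power_sum N (Suc k) x)
        + disc N x * loop_remainder N k ms x
        + T x * (\<Sum>i<N. x i ^ Suc k * disc_deriv N i x) - T x * (\<Sum>i<N. x i ^ Suc (Suc k) * disc_deriv N i x)"
      unfolding Gi sum.distrib sum_subtractf sum_distrib_left[symmetric] loop_remainder_def T'_def pk by simp
    \<comment> \<open>The diagonal corrections \<open>(k + 1) * power_sum N k x\<close> and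
      \<open>(k + 2) * power_sum N (Suc k) x\<close> from the discriminant turn the coefficients
      \<open>k + a\<close> and \<open>k + a + b\<close> into \<open>a - 1\<close> and
      \<open>a + b - 2\<close>.\<close>
    also have "\<dots> = ?F x"
      unfolding sum_power_mult_disc_deriv T_def by (simp add: algebra_simps)
    finally show ?thesis .
  qed
  then have "jacobi_integral N a b ?F = jacobi_integral N a b (\<lambda>x. \<Sum>i<N. G i x)" by simp
  also have "\<dots> = (\<Sum>i<N. jacobi_integral N a b (G i))"
  proof (rule jacobi_integral_sum[OF assms])
    show "cube_bounded N (G i)" if "i \<in> {..<N}" for i
      unfolding G_def using that cube_bounded[of i]
      by (intro cube_bounded_add cube_bounded_mult cube_bounded_diff cube_bounded_coord cube_bounded_const) auto
  qed
  also have "\<dots> = 0" using 0 by simp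
  finally show ?thesis .
qed

subsection \<open>Normalised averages and their limits\<close>

text \<open>A nonnegative integrand with zero integral vanishes almost everywhere, so it suffices to
  find a set of positive measure on which it is nonzero. This makes the normalisation of the
  averages legitimate.\<close>

lemma jacobi_integral_disc_pos:
  assumes "0 < a" "0 < b"
  shows "0 < jacobi_integral N a b (disc N)"
proof -
  let ?M = "PiM {..<N} (\<lambda>_. lborel :: real measure)"
  \<comment> \<open>Consecutive disjoint intervals force the coordinates of a point of the box to
    increase strictly inside the open unit interval, so neither the discriminant nor any weight
    vanishes there.\<close>
  define A where "A i = {real i / real N <..< (real i + 1) / real N}" for i
  have int: "integrable ?M (\<lambda>x. disc N x * jacobi_density N a b x)"
    by (rule integrable_cube_bounded[OF assms cube_bounded_disc])
  have nonneg: "0 \<le> disc N x * jacobi_density N a b x" for x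
    by (intro mult_nonneg_nonneg disc_nonneg jacobi_density_nonneg)
  have box: "disc N x * jacobi_density N a b x \<noteq> 0" if x: "x \<in> PiE {..<N} A" for x
  proof -
    have xi: "real i / real N < x i" "x i < (real i + 1) / real N" if "i < N" for i
      using x that by (auto simp: A_def PiE_iff)
    have less: "x p < x q" if "p < q" "q < N" for p q
    proof -
      have "x p < (real p + 1) / real N" using xi that by simp
      also have "\<dots> \<le> real q / real N" using that by (intro divide_right_mono) auto
      also have "\<dots> < x q" using xi that by simp
      finally show ?thesis .
    qed
    have "(x p - x q)\<^sup>2 \<noteq> 0" if "(p, q) \<in> index_pairs N" for p q
      using index_pairsD[OF that] less[of p q] by simp
    then have "disc N x \<noteq> 0"
      unfolding disc_def by auto
    moreover have "jacobi_weight a b (x i) \<noteq> 0" if "i < N" for i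
    proof -
      have "0 \<le> real i / real N" "(real i + 1) / real N \<le> 1" using that by (auto simp: field_simps)
      then have "0 < x i" "x i < 1" using xi[OF that] by linarith+
      then show ?thesis by (simp add: jacobi_weight_def)
    qed
    ultimately show ?thesis by (simp add: jacobi_density_def)
  qed
  have "emeasure ?M (PiE {..<N} A) = (\<Prod>i<N. emeasure lborel (A i))"
    by (rule lborel_prod.emeasure_PiM) (auto simp: A_def)
  also have "\<dots> = (\<Prod>i<N. ennreal (1 / real N))"
    by (intro prod.cong refl) (auto simp: A_def diff_divide_distrib[symmetric] divide_right_mono)
  also have "\<dots> \<noteq> 0" by auto
  finally have pos: "emeasure ?M (PiE {..<N} A) \<noteq> 0" .
  have "jacobi_integral N a b (disc N) \<noteq> 0"
  proof
    assume "jacobi_integral N a b (disc N) = 0"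
    then have "AE x in ?M. disc N x * jacobi_density N a b x = 0"
      unfolding jacobi_integral_def
      using integral_nonneg_eq_0_iff_AE[OF int] nonneg by simp
    then have "AE x in ?M. x \<notin> PiE {..<N} A"
      by eventually_elim (use box in blast)
    moreover have "PiE {..<N} A \<in> sets ?M"
      by (intro sets_PiM_I_finite) (auto simp: A_def)
    ultimately have "emeasure ?M (PiE {..<N} A) = 0"
      by (subst (asm) AE_iff_measurable[OF _ refl])
         (auto dest: sets.sets_into_space intro!: arg_cong[of _ _ "emeasure ?M"] elim!: back_subst[of "\<lambda>X. emeasure ?M X = 0"])
    then show False using pos by simp
  qed
  moreover have "0 \<le> jacobi_integral N a b (disc N)"
    unfolding jacobi_integral_def using nonneg by (intro Bochner_Integration.integral_nonneg) auto
  ultimately show ?thesis by simp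
qed

section \<open>Averages normalised by the total mass\<close>

definition jacobi_mean :: "nat \<Rightarrow> real \<Rightarrow> real \<Rightarrow> ((nat \<Rightarrow> real) \<Rightarrow> real) \<Rightarrow> real" where
  "jacobi_mean N a b f = jacobi_integral N a b (\<lambda>x. disc N x * f x) / jacobi_integral N a b (disc N)"

lemma selberg_avg_eq: "selberg_avg N a b f = jacobi_integral N a b (\<lambda>x. disc N x * f x) / fact N"
proof -
  have "(LINT x:PiE {..<N} (\<lambda>_. {0..1})|PiM {..<N} (\<lambda>_. lborel). f x * (\<Prod>i<N. \<Prod>j\<in>{i<..<N}. (x i - x j)\<^sup>2)
        * (\<Prod>i<N. x i powr (a - 1) * (1 - x i) powr (b - 1)))
      = (LINT x|PiM {..<N} (\<lambda>_. lborel). disc N x * f x * jacobi_density N a b x)"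
    unfolding set_lebesgue_integral_def
  proof (rule Bochner_Integration.integral_cong[OF refl])
    fix x :: "nat \<Rightarrow> real" assume "x \<in> space (PiM {..<N} (\<lambda>_. lborel))"
    \<comment> \<open>Points of the product space are extensional, so membership in the cube reduces
      to the coordinate conditions and its indicator splits into factors for the weights.\<close>
    then have "indicator (PiE {..<N} (\<lambda>_. {0..1::real})) x = (\<Prod>i<N. indicator {0..1} (x i) :: real)"
      by (auto simp: indicator_def space_PiM PiE_iff of_bool_def)
    then show "indicator (PiE {..<N} (\<lambda>_. {0..1})) x *\<^sub>R (f x * (\<Prod>i<N. \<Prod>j\<in>{i<..<N}. (x i - x j)\<^sup>2)
        * (\<Prod>i<N. x i powr (a - 1) * (1 - x i) powr (b - 1))) = disc N x * f x * jacobi_density N a b x"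
      by (simp add: disc_eq jacobi_density_def jacobi_weight_def prod.distrib mult_ac)
  qed
  then show ?thesis unfolding selberg_avg_def jacobi_integral_def by simp
qed

lemma I_moment_eq: "I_moment N a b k = jacobi_mean N a b (power_sum N k)"
  unfolding I_moment_def jacobi_mean_def selberg_avg_eq by simp

lemma jacobi_mean_add:
  assumes "0 < a" "0 < b" "cube_bounded N f" "cube_bounded N g"
  shows "jacobi_mean N a b (\<lambda>x. f x + g x) = jacobi_mean N a b f + jacobi_mean N a b g"
  unfolding jacobi_mean_def distrib_left
  by (simp add: jacobi_integral_add[OF assms(1,2) cube_bounded_mult[OF cube_bounded_disc assms(3)] cube_bounded_mult[OF cube_bounded_disc assms(4)]]
      add_divide_distrib)

lemma jacobi_mean_cmult: "jacobi_mean N a b (\<lambda>x. c * f x) = c * jacobi_mean N a b f"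
  unfolding jacobi_mean_def using jacobi_integral_cmult[of N a b c "\<lambda>x. disc N x * f x"] by (simp add: mult_ac)

lemma jacobi_mean_diff:
  assumes "0 < a" "0 < b" "cube_bounded N f" "cube_bounded N g"
  shows "jacobi_mean N a b (\<lambda>x. f x - g x) = jacobi_mean N a b f - jacobi_mean N a b g"
  using jacobi_mean_add[OF assms(1-3) cube_bounded_mult[OF cube_bounded_const assms(4)], of "-1"] jacobi_mean_cmult[of N a b "-1" g]
  by simp

lemma jacobi_mean_sum:
  assumes "0 < a" "0 < b" "\<And>s. s \<in> S \<Longrightarrow> cube_bounded N (f s)"
  shows "jacobi_mean N a b (\<lambda>x. \<Sum>s\<in>S. f s x) = (\<Sum>s\<in>S. jacobi_mean N a b (f s))"
  unfolding jacobi_mean_def sum_distrib_left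
  by (subst jacobi_integral_sum[OF assms(1,2)]) (auto intro: cube_bounded_disc assms(3) simp: sum_divide_distrib)

lemma jacobi_mean_const:
  assumes "0 < a" "0 < b"
  shows "jacobi_mean N a b (\<lambda>_. c) = c"
  using jacobi_integral_disc_pos[OF assms, of N] jacobi_integral_cmult[of N a b c "disc N"]
  by (simp add: jacobi_mean_def mult.commute)

lemma jacobi_mean_mono:
  assumes "0 < a" "0 < b" "cube_bounded N f" "cube_bounded N g"
    and "\<And>x. (\<And>i. i < N \<Longrightarrow> x i \<in> {0..1}) \<Longrightarrow> f x \<le> g x"
  shows "jacobi_mean N a b f \<le> jacobi_mean N a b g"
  unfolding jacobi_mean_def using assms jacobi_integral_disc_pos[OF assms(1,2), of N] cube_bounded_disc
  by (intro divide_right_mono jacobi_integral_mono mult_left_mono disc_nonneg) auto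

lemma jacobi_mean_abs_le:
  assumes "0 < a" "0 < b" "cube_bounded N f"
    and le: "\<And>x. (\<And>i. i < N \<Longrightarrow> x i \<in> {0..1}) \<Longrightarrow> \<bar>f x\<bar> \<le> C"
  shows "\<bar>jacobi_mean N a b f\<bar> \<le> C"
proof -
  have "jacobi_mean N a b f \<le> jacobi_mean N a b (\<lambda>_. C)" "jacobi_mean N a b (\<lambda>_. - C) \<le> jacobi_mean N a b f"
    by (intro jacobi_mean_mono assms(1-3) cube_bounded_const; use le in \<open>simp add: abs_le_iff minus_le_iff\<close>)+
  then show ?thesis using assms(1,2) by (simp add: jacobi_mean_const)
qed

text \<open>A product of \<open>length ms\<close> power sums has size at most
  \<open>N ^ length ms\<close> on the cube, so this is the scale on which limits can exist. Parts 0
  count in the length and contribute \<open>N\<close> each, hence cancel.\<close>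

definition jacobi_moment :: "nat \<Rightarrow> real \<Rightarrow> real \<Rightarrow> nat list \<Rightarrow> real" where
  "jacobi_moment N a b ms = jacobi_mean N a b (power_sum_prod N ms) / real N ^ length ms"

lemma loop_equation_mean:
  fixes N k :: nat and a b :: real and ms :: "nat list"
  assumes "0 < a" "0 < b"
  defines "E \<equiv> \<lambda>ns. jacobi_mean N a b (power_sum_prod N ns)"
  shows "(2 * real N + a + b - 2) * E (Suc k # ms) =
     (a - 1) * E (k # ms) + (\<Sum>l\<le>k. E (l # (k - l) # ms)) - (\<Sum>l=1..k. E (l # (Suc k - l) # ms))
     + jacobi_mean N a b (loop_remainder N k ms)"
proof -
  note cube_bounded = cube_bounded_power_sum_prod cube_bounded_loop_remainder
  have "jacobi_mean N a b (\<lambda>x. power_sum_prod N ms x *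
      ((a - 1) * power_sum N k x - (a + b - 2) * power_sum N (Suc k) x
       + (\<Sum>l\<le>k. power_sum N l x * power_sum N (k - l) x)
       - (\<Sum>l\<le>Suc k. power_sum N l x * power_sum N (Suc k - l) x)) + loop_remainder N k ms x) = 0"
    unfolding jacobi_mean_def loop_equation_integral[OF assms(1,2)] by simp
  also have "(\<lambda>x. power_sum_prod N ms x *
      ((a - 1) * power_sum N k x - (a + b - 2) * power_sum N (Suc k) x
       + (\<Sum>l\<le>k. power_sum N l x * power_sum N (k - l) x)
       - (\<Sum>l\<le>Suc k. power_sum N l x * power_sum N (Suc k - l) x)) + loop_remainder N k ms x) =
     (\<lambda>x. (a - 1) * power_sum_prod N (k # ms) x - (a + b - 2) * power_sum_prod N (Suc k # ms) x
       + (\<Sum>l\<le>k. power_sum_prod N (l # (k - l) # ms) x)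
       - (\<Sum>l\<le>Suc k. power_sum_prod N (l # (Suc k - l) # ms) x) + loop_remainder N k ms x)"
  proof
    fix x
    have 1: "(\<Sum>l\<le>j. power_sum_prod N (l # (j - l) # ms) x)
       = power_sum_prod N ms x * (\<Sum>l\<le>j. power_sum N l x * power_sum N (j - l) x)" for j
      unfolding sum_distrib_left by (intro sum.cong) simp_all
    show "power_sum_prod N ms x *
      ((a - 1) * power_sum N k x - (a + b - 2) * power_sum N (Suc k) x
       + (\<Sum>l\<le>k. power_sum N l x * power_sum N (k - l) x)
       - (\<Sum>l\<le>Suc k. power_sum N l x * power_sum N (Suc k - l) x)) + loop_remainder N k ms x =
     (a - 1) * power_sum_prod N (k # ms) x - (a + b - 2) * power_sum_prod N (Suc k # ms) x
       + (\<Sum>l\<le>k. power_sum_prod N (l # (k - l) # ms) x)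
       - (\<Sum>l\<le>Suc k. power_sum_prod N (l # (Suc k - l) # ms) x) + loop_remainder N k ms x"
      unfolding 1 unfolding power_sum_prod_simps by (simp only: algebra_simps)
  qed
  also have "jacobi_mean N a b \<dots> = (a - 1) * E (k # ms) - (a + b - 2) * E (Suc k # ms)
       + (\<Sum>l\<le>k. E (l # (k - l) # ms)) - (\<Sum>l\<le>Suc k. E (l # (Suc k - l) # ms))
       + jacobi_mean N a b (loop_remainder N k ms)"
    unfolding E_def jacobi_mean_cmult[symmetric]
    by (subst jacobi_mean_add[OF assms(1,2)] jacobi_mean_diff[OF assms(1,2)] jacobi_mean_sum[OF assms(1,2)];
        (intro cube_bounded cube_bounded_add cube_bounded_diff cube_bounded_sum cube_bounded_mult cube_bounded_const)?)+ simp
  \<comment> \<open>The end terms \<open>l = 0\<close> and \<open>l = Suc k\<close> contain the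
    factor \<open>power_sum N 0 = N\<close> and reproduce the unknown \<open>E (Suc k # ms)\<close>.
    Moved to the left they give the coefficient \<open>2 * real N\<close>; what remains involves
    only parts at most \<open>k\<close> besides \<open>ms\<close>.\<close>
  also have "(\<Sum>l\<le>Suc k. E (l # (Suc k - l) # ms)) =
      2 * real N * E (Suc k # ms) + (\<Sum>l=1..k. E (l # (Suc k - l) # ms))"
  proof -
    have "{..Suc k} = insert 0 (insert (Suc k) {1..k})" by auto
    moreover have "E (0 # Suc k # ms) = real N * E (Suc k # ms)" "E (Suc k # 0 # ms) = real N * E (Suc k # ms)"
      unfolding E_def jacobi_mean_cmult[symmetric] by (simp_all add: power_sum_prod_simps[abs_def] mult_ac)
    ultimately show ?thesis by simp
  qed
  finally show ?thesis by (simp add: algebra_simps)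
qed

lemma jacobi_moment_Nil: "0 < a \<Longrightarrow> 0 < b \<Longrightarrow> jacobi_moment N a b [] = 1"
  by (simp add: jacobi_moment_def power_sum_prod_simps(1)[abs_def] jacobi_mean_const)

lemma jacobi_moment_Cons_0:
  "0 < N \<Longrightarrow> jacobi_moment N a b (0 # ms) = jacobi_moment N a b ms"
  using jacobi_mean_cmult[of N a b "real N" "power_sum_prod N ms"]
  by (simp add: jacobi_moment_def power_sum_prod_simps(2)[abs_def])

text \<open>Dividing by \<open>N ^ (length ms + 2)\<close> makes the quadratic terms of order one.
  The term with \<open>(a - 1) / real N\<close> has to be kept, since \<open>a\<close> may grow
  linearly in \<open>N\<close>.\<close>

lemma loop_equation_moment:
  fixes N k :: nat and a b :: real and ms :: "nat list"
  assumes "0 < a" "0 < b" "0 < N"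
  defines "M \<equiv> jacobi_moment N a b"
  shows "(2 + (a + b - 2) / real N) * M (Suc k # ms) =
     (a - 1) / real N * M (k # ms) + (\<Sum>l\<le>k. M (l # (k - l) # ms)) - (\<Sum>l=1..k. M (l # (Suc k - l) # ms))
     + jacobi_mean N a b (loop_remainder N k ms) / real N ^ (length ms + 2)"
proof -
  define E where "E ns = jacobi_mean N a b (power_sum_prod N ns)" for ns
  define c where "c = real N ^ (length ms + 2)"
  have N: "real N \<noteq> 0" using assms by simp
  have M2: "M (p # q # ms) = E (p # q # ms) / c" for p q
    by (simp add: M_def jacobi_moment_def E_def c_def)
  have M1: "M (p # ms) = real N * E (p # ms) / c" for p
    using N by (simp add: M_def jacobi_moment_def E_def c_def)
  have "(2 + (a + b - 2) / real N) * M (Suc k # ms) = (2 * real N + a + b - 2) * E (Suc k # ms) / c"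
  proof -
    have "(2 + (a + b - 2) / real N) * real N = 2 * real N + a + b - 2"
      using N by (simp add: field_simps)
    then show ?thesis unfolding M1 by (metis mult.assoc times_divide_eq_right)
  qed
  also have "\<dots> = ((a - 1) * E (k # ms) + (\<Sum>l\<le>k. E (l # (k - l) # ms))
     - (\<Sum>l=1..k. E (l # (Suc k - l) # ms)) + jacobi_mean N a b (loop_remainder N k ms)) / c"
    unfolding E_def loop_equation_mean[OF assms(1,2)] ..
  also have "\<dots> = (a - 1) / real N * M (k # ms) + (\<Sum>l\<le>k. M (l # (k - l) # ms))
     - (\<Sum>l=1..k. M (l # (Suc k - l) # ms)) + jacobi_mean N a b (loop_remainder N k ms) / c"
  proof -
    have "(a - 1) / real N * M (k # ms) = (a - 1) * E (k # ms) / c"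
      unfolding M1 using N by simp
    then show ?thesis
      unfolding M2 by (simp only: add_divide_distrib diff_divide_distrib sum_divide_distrib)
  qed
  finally show ?thesis unfolding c_def .
qed

text \<open>
  The induction measure below gives a part \<open>m\<close> the weight \<open>2 m\<^sup>2 + 1\<close> instead of \<open>m\<^sup>2\<close>: parts \<open>0\<close> must
  count, but the replacement of \<open>1\<close> by \<open>0, 0\<close> must still decrease the total.
\<close>

lemma split_weight_less:
  fixes k l :: nat
  shows "l \<le> k \<Longrightarrow> 2 * l\<^sup>2 + 1 + (2 * (k - l)\<^sup>2 + 1) < 2 * (Suc k)\<^sup>2 + 1"
    and "1 \<le> l \<Longrightarrow> l \<le> k \<Longrightarrow> 2 * l\<^sup>2 + 1 + (2 * (Suc k - l)\<^sup>2 + 1) < 2 * (Suc k)\<^sup>2 + 1"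
proof -
  \<comment> \<open>Splitting a number into \<open>p + q\<close> lowers the doubled squares by
    \<open>4 * (p * q)\<close>. In the second claim this is at least 4 and beats the extra 1 of the
    new part; in the first the drop from \<open>Suc k\<close> to \<open>k\<close> already
    suffices.\<close>
  have sq: "2 * p\<^sup>2 + 2 * q\<^sup>2 + 4 * (p * q) = 2 * (p + q)\<^sup>2" for p q :: nat
    by (simp add: power2_eq_square algebra_simps)
  show "2 * l\<^sup>2 + 1 + (2 * (k - l)\<^sup>2 + 1) < 2 * (Suc k)\<^sup>2 + 1" if "l \<le> k"
  proof -
    have "2 * l\<^sup>2 + 2 * (k - l)\<^sup>2 \<le> 2 * k\<^sup>2"
      using sq[of l "k - l"] that by simp
    moreover have "(Suc k)\<^sup>2 = k\<^sup>2 + 2 * k + 1"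
      by (simp add: power2_eq_square)
    ultimately show ?thesis by linarith
  qed
  show "2 * l\<^sup>2 + 1 + (2 * (Suc k - l)\<^sup>2 + 1) < 2 * (Suc k)\<^sup>2 + 1" if "1 \<le> l" "l \<le> k"
  proof -
    have "0 < l * (Suc k - l)" using that by simp
    moreover have "2 * l\<^sup>2 + 2 * (Suc k - l)\<^sup>2 + 4 * (l * (Suc k - l)) = 2 * (Suc k)\<^sup>2"
      using sq[of l "Suc k - l"] that by simp
    ultimately show ?thesis by linarith
  qed
qed

text \<open>The induction runs over all lists at once. A leading part 0 drops out, and a leading
  positive part is removed by the loop equation, whose right-hand moments all have smaller weight;
  the limit itself is never computed.\<close>

lemma jacobi_moment_convergent:
  fixes a b :: "nat \<Rightarrow> real"
  assumes pos: "\<And>N. 1 \<le> N \<Longrightarrow> 0 < a N" "\<And>N. 1 \<le> N \<Longrightarrow> 0 < b N"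
    and lim: "(\<lambda>N. a N / real N) \<longlonglongrightarrow> \<alpha>" "(\<lambda>N. b N / real N) \<longlonglongrightarrow> \<beta>"
  shows "convergent (\<lambda>N. jacobi_moment N (a N) (b N) ms)"
proof (induction ms rule: measure_induct_rule[where f = "\<lambda>ms. \<Sum>m\<leftarrow>ms. 2 * m\<^sup>2 + 1"])
  case (less ms)
  define M where "M ns N = jacobi_moment N (a N) (b N) ns" for ns N
  have IH: "convergent (M ns)" if "(\<Sum>m\<leftarrow>ns. 2 * m\<^sup>2 + 1) < (\<Sum>m\<leftarrow>ms. 2 * m\<^sup>2 + 1)" for ns
    unfolding M_def by (rule less[OF that])
  \<comment> \<open>Positivity of the parameters is known only from \<open>N = 1\<close> on, so the
    identities are used eventually.\<close>
  have ev: "eventually (\<lambda>N::nat. 1 \<le> N) sequentially" by (rule eventually_ge_at_top)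
  consider "ms = []" | ns where "ms = 0 # ns" | k ns where "ms = Suc k # ns"
    by (metis list.exhaust not0_implies_Suc)
  then have "convergent (M ms)"
  proof cases
    case 1
    have "eventually (\<lambda>N. M ms N = 1) sequentially"
      using ev by eventually_elim (simp add: 1 M_def jacobi_moment_Nil pos)
    then show ?thesis by (rule convergentI[OF tendsto_eventually])
  next
    case 2
    have "eventually (\<lambda>N. M ms N = M ns N) sequentially"
      using ev by eventually_elim (simp add: 2 M_def jacobi_moment_Cons_0)
    then show ?thesis using IH[of ns] convergent_cong[of "M ms" "M ns"] by (simp add: 2)
  next
    case 3
    define R where "R N = jacobi_mean N (a N) (b N) (loop_remainder N k ns) / real N ^ (length ns + 2)" for N
    define X where "X N = (a N - 1) / real N * M (k # ns) N + (\<Sum>l\<le>k. M (l # (k - l) # ns) N)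
        - (\<Sum>l=1..k. M (l # (Suc k - l) # ns) N) + R N" for N
    define D where "D N = 2 + (a N + b N - 2) / real N" for N
    have inv: "(\<lambda>N. c / real N) \<longlonglongrightarrow> 0" for c :: real
      by (rule lim_const_over_n)
    have aN: "(\<lambda>N. (a N - 1) / real N) \<longlonglongrightarrow> \<alpha>"
      using tendsto_diff[OF lim(1) inv[of 1]] by (simp add: diff_divide_distrib)
    have D: "D \<longlonglongrightarrow> 2 + (\<alpha> + \<beta>)"
      unfolding D_def add_divide_distrib diff_divide_distrib
      using tendsto_add[OF tendsto_const tendsto_diff[OF tendsto_add[OF lim] inv[of 2]]] by simp
    have "eventually (\<lambda>N. 0 \<le> a N / real N) sequentially" "eventually (\<lambda>N. 0 \<le> b N / real N) sequentially"
      using ev by (eventually_elim, simp add: pos less_imp_le)+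
    \<comment> \<open>As limits of eventually nonnegative sequences, both slopes are nonnegative, so
      the leading coefficient \<open>D\<close> tends to a limit of at least 2 and can be divided
      out.\<close>
    then have "0 \<le> \<alpha>" "0 \<le> \<beta>"
      using tendsto_lowerbound[OF lim(1)] tendsto_lowerbound[OF lim(2)] by auto
    then have D0: "2 + (\<alpha> + \<beta>) \<noteq> 0" by linarith
    have R: "R \<longlonglongrightarrow> 0"
    proof (rule Lim_null_comparison)
      show "(\<lambda>N. real (sum_list ns) / real N) \<longlonglongrightarrow> 0" by (rule inv)
      show "eventually (\<lambda>N. norm (R N) \<le> real (sum_list ns) / real N) sequentially"
        using ev
      proof eventually_elim
        case (elim N)
        have abs_eq: "\<bar>real N ^ (length ns + 2)\<bar> = real N ^ (length ns + 2)"
          by simp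
        have "\<bar>jacobi_mean N (a N) (b N) (loop_remainder N k ns)\<bar> \<le> real (sum_list ns) * real N ^ length ns"
          by (intro jacobi_mean_abs_le pos elim cube_bounded_loop_remainder loop_remainder_bound)
        then have "norm (R N) \<le> real (sum_list ns) * real N ^ length ns / real N ^ (length ns + 2)"
          unfolding R_def real_norm_def abs_divide abs_eq by (rule divide_right_mono) simp
        also have "\<dots> = real (sum_list ns) / real N / real N"
          using elim by (simp add: power_add power2_eq_square)
        also have "\<dots> \<le> real (sum_list ns) / real N / 1"
          using elim by (intro divide_left_mono) auto
        \<comment> \<open>The remainder is in fact of order \<open>1 / N\<close> squared; one factor
          is given up, since any null bound is enough.\<close>
        finally show ?case by simp
      qed
    qed
    have "convergent (M (k # ns))"
      by (rule IH) (simp add: 3 power2_eq_square)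
    then have c1: "convergent (\<lambda>N. (a N - 1) / real N * M (k # ns) N)"
      by (rule convergent_mult[OF convergentI[OF aN]])
    have c2: "convergent (\<lambda>N. \<Sum>l\<le>k. M (l # (k - l) # ns) N)"
    proof (rule convergent_sum)
      show "convergent (M (l # (k - l) # ns))" if "l \<in> {..k}" for l
        using split_weight_less(1)[of l k] that by (intro IH) (simp add: 3)
    qed
    have c3: "convergent (\<lambda>N. \<Sum>l=1..k. M (l # (Suc k - l) # ns) N)"
    proof (rule convergent_sum)
      show "convergent (M (l # (Suc k - l) # ns))" if "l \<in> {1..k}" for l
        using split_weight_less(2)[of l k] that by (intro IH) (simp add: 3)
    qed
    have "convergent X"
      unfolding X_def by (rule convergent_add[OF convergent_diff[OF convergent_add[OF c1 c2] c3] convergentI[OF R]])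
    then obtain L where L: "X \<longlonglongrightarrow> L" by (auto simp: convergent_def)
    have "eventually (\<lambda>N. D N \<noteq> 0) sequentially"
      using D D0 by (rule tendsto_imp_eventually_ne)
    then have "eventually (\<lambda>N. X N / D N = M ms N) sequentially"
      using ev
    proof eventually_elim
      case (elim N)
      have "D N * M ms N = X N"
        using loop_equation_moment[OF pos(1)[OF elim(2)] pos(2)[OF elim(2)], where k = k and ms = ns] elim
        by (simp add: D_def M_def X_def R_def 3)
      then show ?case using elim by (simp add: field_simps)
    qed
    then have "M ms \<longlonglongrightarrow> L / (2 + (\<alpha> + \<beta>))"
      by (rule Lim_transform_eventually[OF tendsto_divide[OF L D D0]])
    then show ?thesis by (rule convergentI)
  qed
  then show ?case by (simp add: M_def[abs_def])
qed

theorem theorem1: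
  fixes a0 a1 b0 b1 :: real and k :: nat
  assumes "\<And>N::nat. N \<ge> 1 \<Longrightarrow> a1 * real N + a0 > 0"
      and "\<And>N::nat. N \<ge> 1 \<Longrightarrow> b1 * real N + b0 > 0"
      and "k \<ge> 1"
  shows "\<exists>L::real. (\<lambda>N. I_moment N (a1 * real N + a0) (b1 * real N + b0) k / real N)
                     \<longlonglongrightarrow> L"
proof -
  have lim: "(\<lambda>N. (c * real N + d) / real N) \<longlonglongrightarrow> c" for c d :: real
  proof (rule Lim_transform_eventually)
    show "(\<lambda>N. c + d / real N) \<longlonglongrightarrow> c"
      using tendsto_add[OF tendsto_const lim_const_over_n, of c d] by simp
    show "eventually (\<lambda>N. c + d / real N = (c * real N + d) / real N) sequentially"
      using eventually_gt_at_top[of 0] by eventually_elim (simp add: field_simps)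
  qed
  \<comment> \<open>For the one-part list the moment is exactly \<open>I_moment\<close> divided by
    \<open>N\<close>.\<close>
  have "convergent (\<lambda>N. jacobi_moment N (a1 * real N + a0) (b1 * real N + b0) [k])"
    by (rule jacobi_moment_convergent[OF assms(1,2) lim lim])
  then show ?thesis
    by (simp add: convergent_def jacobi_moment_def power_sum_prod_simps[abs_def] I_moment_eq)
qed

end
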